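(* There exists a frame $(x_j)_{j\ge1}$ in an infinite-dimensional separable Hilbert space $H$ such that no subsequence of $(x_j)$ is a basis with brackets of $H$.
   Context: A sequence $(x_j)$ in a Hilbert space $H$ is called a frame if there exist positive numbers $A,B$ such that $A\|x\|^2\le\sum_j|\langle x,x_j\rangle|^2\le B\|x\|^2$ for all $x\in H$. A sequence $(x_n)_{n=1}^\infty$ in a Banach space $X$ is called a basis with brackets (of $X$) if there are integers $1<n_1<n_2<\dots$ such that every vector $x\in X$ admits a unique representation of the form $x=\lim_{j}\sum_{n=1}^{n_j}a_nx_n$ with $a_n\in\mathbb{R}$ (limit in norm; uniqueness refers to the coefficient sequence $(a_n)$). Scalars are real. *)

theory Defs
  imports "HOL-Analysis.Analysis"
begin

section \<open>The real Hilbert space of square-summable sequences\<close>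

text \<open>
  Every infinite-dimensional separable real Hilbert space is isometric to this one. HOL cannot
  quantify existentially over types, so this type serves as the space \<open>H\<close> whose
  existence is asserted.
\<close>

typedef ell2 = "{f :: nat \<Rightarrow> real. summable (\<lambda>n. (f n)\<^sup>2)}"
  morphisms coord Abs_ell2
  by (rule exI[of _ "\<lambda>_. 0"]) simp

setup_lifting type_definition_ell2

lemma summable_square_coord: "summable (\<lambda>n. (coord x n)\<^sup>2)"
  using coord[of x] by simp

lemma summable_mult_of_square_summable:
  fixes f g :: "nat \<Rightarrow> real"
  assumes "summable (\<lambda>n. (f n)\<^sup>2)" "summable (\<lambda>n. (g n)\<^sup>2)"
  shows "summable (\<lambda>n. f n * g n)"
proof (rule summable_comparison_test')
  show "summable (\<lambda>n. (f n)\<^sup>2 + (g n)\<^sup>2)"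
    using assms by (rule summable_add)
  fix n :: nat
  have "0 \<le> (\<bar>f n\<bar> - \<bar>g n\<bar>)\<^sup>2" "0 \<le> \<bar>f n\<bar> * \<bar>g n\<bar>" by simp_all
  then show "norm (f n * g n) \<le> (f n)\<^sup>2 + (g n)\<^sup>2"
    unfolding power2_diff real_norm_def abs_mult power2_abs by linarith
qed

lemma summable_coord_mult: "summable (\<lambda>n. coord x n * coord y n)"
  by (intro summable_mult_of_square_summable summable_square_coord)

instantiation ell2 :: real_vector
begin

lift_definition zero_ell2 :: ell2 is "\<lambda>_. 0" by simp

lift_definition plus_ell2 :: "ell2 \<Rightarrow> ell2 \<Rightarrow> ell2" is "\<lambda>f g n. f n + g n"
  by (simp add: power2_sum mult.assoc summable_add summable_mult summable_mult_of_square_summable)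

lift_definition minus_ell2 :: "ell2 \<Rightarrow> ell2 \<Rightarrow> ell2" is "\<lambda>f g n. f n - g n"
  by (simp add: power2_diff mult.assoc summable_add summable_diff summable_mult
      summable_mult_of_square_summable)

lift_definition uminus_ell2 :: "ell2 \<Rightarrow> ell2" is "\<lambda>f n. - f n" by simp

lift_definition scaleR_ell2 :: "real \<Rightarrow> ell2 \<Rightarrow> ell2" is "\<lambda>c f n. c * f n"
  by (simp add: power_mult_distrib summable_mult)

instance
  by standard (transfer, simp add: algebra_simps fun_eq_iff)+

end

lemma coord_0 [simp]: "coord 0 n = 0"
  and coord_add [simp]: "coord (x + y) n = coord x n + coord y n"
  and coord_diff [simp]: "coord (x - y) n = coord x n - coord y n"
  and coord_minus [simp]: "coord (- x) n = - coord x n"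
  and coord_scaleR [simp]: "coord (c *\<^sub>R x) n = c * coord x n"
  by (transfer, simp)+

lemma ell2_eqI: "(\<And>n. coord x n = coord y n) \<Longrightarrow> x = y"
  by transfer auto

instantiation ell2 :: real_inner
begin

definition inner_ell2 :: "ell2 \<Rightarrow> ell2 \<Rightarrow> real"
  where "inner_ell2 x y = (\<Sum>n. coord x n * coord y n)"

definition norm_ell2 :: "ell2 \<Rightarrow> real"
  where "norm_ell2 x = sqrt (x \<bullet> x)"

definition dist_ell2 :: "ell2 \<Rightarrow> ell2 \<Rightarrow> real"
  where "dist_ell2 x y = norm (x - y)"

definition sgn_ell2 :: "ell2 \<Rightarrow> ell2"
  where "sgn_ell2 x = x /\<^sub>R norm x"

definition uniformity_ell2 :: "(ell2 \<times> ell2) filter"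
  where "uniformity_ell2 = (INF e\<in>{0<..}. principal {(x, y). dist x y < e})"

definition open_ell2 :: "ell2 set \<Rightarrow> bool"
  where "open_ell2 U \<longleftrightarrow> (\<forall>x\<in>U. \<forall>\<^sub>F (x', y) in uniformity. x' = x \<longrightarrow> y \<in> U)"

instance
proof
  fix x y z :: ell2 and r :: real and U :: "ell2 set"
  show "dist x y = norm (x - y)" by (rule dist_ell2_def)
  show "sgn x = x /\<^sub>R norm x" by (rule sgn_ell2_def)
  show "uniformity = (INF e\<in>{0<..}. principal {(x :: ell2, y). dist x y < e})"
    by (rule uniformity_ell2_def)
  show "open U \<longleftrightarrow> (\<forall>x\<in>U. \<forall>\<^sub>F (x', y) in uniformity. x' = x \<longrightarrow> y \<in> U)"
    by (rule open_ell2_def)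
  show "x \<bullet> y = y \<bullet> x"
    by (simp add: inner_ell2_def mult.commute)
  show "(x + y) \<bullet> z = x \<bullet> z + y \<bullet> z"
    by (simp add: inner_ell2_def distrib_right suminf_add summable_coord_mult)
  show "(r *\<^sub>R x) \<bullet> y = r * (x \<bullet> y)"
    by (simp add: inner_ell2_def mult.assoc suminf_mult summable_coord_mult)
  show "0 \<le> x \<bullet> x"
    unfolding inner_ell2_def by (intro suminf_nonneg summable_coord_mult) simp
  show "x \<bullet> x = 0 \<longleftrightarrow> x = 0"
    unfolding inner_ell2_def
    by (subst suminf_eq_zero_iff[OF summable_coord_mult]) (auto intro: ell2_eqI)
  show "norm x = sqrt (x \<bullet> x)" by (rule norm_ell2_def)
qed

end

lemma power2_norm_ell2: "(norm x)\<^sup>2 = (\<Sum>n. (coord x n)\<^sup>2)"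
  unfolding power2_norm_eq_inner inner_ell2_def by (simp add: power2_eq_square)

lemma sum_square_coord_le_norm: "(\<Sum>n<k. (coord x n)\<^sup>2) \<le> (norm x)\<^sup>2"
proof -
  have "(\<Sum>n<k. (coord x n)\<^sup>2) \<le> (\<Sum>n. (coord x n)\<^sup>2)"
    by (intro sum_le_suminf summable_square_coord) auto
  also have "\<dots> = (norm x)\<^sup>2"
    by (simp add: power2_norm_ell2)
  finally show ?thesis .
qed

lemma norm_ell2_le:
  assumes "\<And>k. (\<Sum>n<k. (coord x n)\<^sup>2) \<le> c\<^sup>2" "0 \<le> c"
  shows "norm x \<le> c"
proof -
  have "(norm x)\<^sup>2 = (\<Sum>n. (coord x n)\<^sup>2)"
    by (simp add: power2_norm_ell2)
  also have "\<dots> \<le> c\<^sup>2"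
    by (intro suminf_le_const summable_square_coord assms)
  finally show ?thesis using assms(2) by (rule power2_le_imp_le)
qed

lemma abs_coord_le_norm: "\<bar>coord x n\<bar> \<le> norm x"
proof -
  have "(coord x n)\<^sup>2 \<le> (\<Sum>i<Suc n. (coord x i)\<^sup>2)"
    by (simp add: sum_nonneg)
  also have "\<dots> \<le> (norm x)\<^sup>2" by (rule sum_square_coord_le_norm)
  finally show ?thesis by (simp add: abs_le_square_iff[symmetric])
qed

instance ell2 :: complete_space
proof
  fix X :: "nat \<Rightarrow> ell2"
  assume X: "Cauchy X"
  have "Cauchy (\<lambda>i. coord (X i) n)" for n
  proof (rule CauchyI)
    fix e :: real assume "0 < e"
    then obtain M where M: "\<forall>i\<ge>M. \<forall>j\<ge>M. norm (X i - X j) < e"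
      using CauchyD[OF X] by blast
    have "norm (coord (X i) n - coord (X j) n) < e" if "M \<le> i" "M \<le> j" for i j
      using abs_coord_le_norm[of "X i - X j" n] M that
      by (metis coord_diff le_less_trans real_norm_def)
    then show "\<exists>M. \<forall>i\<ge>M. \<forall>j\<ge>M. norm (coord (X i) n - coord (X j) n) < e"
      by blast
  qed
  then have "\<forall>n. \<exists>l. (\<lambda>i. coord (X i) n) \<longlonglongrightarrow> l"
    by (simp add: Cauchy_convergent_iff convergent_def)
  then obtain l where l: "\<And>n. (\<lambda>i. coord (X i) n) \<longlonglongrightarrow> l n" by metis
  have partial: "(\<Sum>n<k. (coord (X i) n - l n)\<^sup>2) \<le> e\<^sup>2"
    if "\<forall>i\<ge>M. \<forall>j\<ge>M. norm (X i - X j) < e" "M \<le> i" for e M i k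
  proof (rule LIMSEQ_le_const2)
    show "(\<lambda>j. \<Sum>n<k. (coord (X i) n - coord (X j) n)\<^sup>2)
        \<longlonglongrightarrow> (\<Sum>n<k. (coord (X i) n - l n)\<^sup>2)"
      by (intro tendsto_intros l)
    have "(\<Sum>n<k. (coord (X i) n - coord (X j) n)\<^sup>2) \<le> e\<^sup>2" if "M \<le> j" for j
    proof -
      have "(\<Sum>n<k. (coord (X i) n - coord (X j) n)\<^sup>2) \<le> (norm (X i - X j))\<^sup>2"
        using sum_square_coord_le_norm[of "X i - X j" k] by simp
      also have "\<dots> \<le> e\<^sup>2"
        using \<open>\<forall>i\<ge>M. \<forall>j\<ge>M. norm (X i - X j) < e\<close> \<open>M \<le> i\<close> \<open>M \<le> j\<close>
        by (intro power_mono) (auto intro: less_imp_le)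
      finally show ?thesis .
    qed
    then show "\<exists>N. \<forall>j\<ge>N. (\<Sum>n<k. (coord (X i) n - coord (X j) n)\<^sup>2) \<le> e\<^sup>2"
      by blast
  qed
  obtain M where M: "\<forall>i\<ge>M. \<forall>j\<ge>M. norm (X i - X j) < 1"
    using CauchyD[OF X, of 1] by auto
  have "summable (\<lambda>n. (coord (X M) n - l n)\<^sup>2)"
    using partial[OF M order_refl] by (intro summableI_nonneg_bounded) auto
  then have d: "coord (Abs_ell2 (\<lambda>n. coord (X M) n - l n)) n = coord (X M) n - l n" for n
    by (subst Abs_ell2_inverse) auto
  define L where "L = X M - Abs_ell2 (\<lambda>n. coord (X M) n - l n)"
  have L: "coord L n = l n" for n
    by (simp add: L_def d)
  have "X \<longlonglongrightarrow> L"
  proof (rule LIMSEQ_I)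
    fix r :: real assume "0 < r"
    then obtain K where K: "\<forall>i\<ge>K. \<forall>j\<ge>K. norm (X i - X j) < r / 2"
      using CauchyD[OF X, of "r / 2"] by auto
    have "norm (X i - L) \<le> r / 2" if "K \<le> i" for i
      using partial[OF K that] \<open>0 < r\<close> by (intro norm_ell2_le) (auto simp: L)
    then show "\<exists>K. \<forall>i\<ge>K. norm (X i - L) < r"
      using \<open>0 < r\<close> by (intro exI[of _ K] allI impI) (auto intro: le_less_trans[of _ "r / 2" r])
  qed
  then show "convergent X" by (rule convergentI)
qed

instance ell2 :: banach ..


section \<open>Frames and bases with brackets\<close>

definition frame :: "(nat \<Rightarrow> 'a :: {real_inner, complete_space}) \<Rightarrow> bool" where
  "frame x \<longleftrightarrow> (\<exists>A B. 0 < A \<and> 0 < B \<and>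
     (\<forall>v. summable (\<lambda>j. \<bar>v \<bullet> x j\<bar>\<^sup>2) \<and>
          A * (norm v)\<^sup>2 \<le> (\<Sum>j. \<bar>v \<bullet> x j\<bar>\<^sup>2) \<and>
          (\<Sum>j. \<bar>v \<bullet> x j\<bar>\<^sup>2) \<le> B * (norm v)\<^sup>2))"

text \<open>
  Sequences are indexed from 0, so the sum of the first \<open>N j\<close> terms ranges over
  \<open>{..<N j}\<close>; the bracket lengths satisfy \<open>1 < N 0 < N 1 < \<dots>\<close>.
\<close>

definition basis_with_brackets :: "(nat \<Rightarrow> 'a :: banach) \<Rightarrow> bool" where
  "basis_with_brackets x \<longleftrightarrow> (\<exists>N :: nat \<Rightarrow> nat. 1 < N 0 \<and> strict_mono N \<and>
     (\<forall>v. \<exists>!a :: nat \<Rightarrow> real. (\<lambda>j. \<Sum>n<N j. a n *\<^sub>R x n) \<longlonglongrightarrow> v))"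

end

theory Submission
  imports Defs "HOL-Library.Discrete_Functions"
begin

text \<open>
  Partition the coordinates into finite blocks \<open>K\<close>. A block of size \<open>d\<close>
  carries the \<open>d + 1\<close> frame vectors \<open>e\<^sub>i - a 1\<^sub>K\<close> (\<open>i \<in> K\<close>) and
  \<open>b 1\<^sub>K\<close>, where \<open>b = 1 / sqrt d\<close> and \<open>a = (1 + b) / d\<close>. They
  form a frame for the block with bounds 1 and 2, and their only linear relation is that they sum
  to 0. A subsequence with unique expansions must therefore omit some vector \<open>x\<^sub>k\<close>
  from each block, and then \<open>x\<^sub>k\<close> can only be expanded with all coefficients
  \<open>-1\<close> over the rest of the block, while a partial sum over a third of the block has norm of
  order \<open>sqrt d\<close>. The blocks are interleaved such that every cut of the sequence leaves some
  block one third complete. Hence the expansion of the sum over all blocks of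
  \<open>b x\<^sub>k\<close> has all late partial sums at a fixed distance from its limit.
\<close>

section \<open>Finitely supported vectors\<close>

definition ell2_on :: "nat set \<Rightarrow> (nat \<Rightarrow> real) \<Rightarrow> ell2" where
  "ell2_on K h = Abs_ell2 (\<lambda>j. if j \<in> K then h j else 0)"

lemma coord_ell2_on:
  assumes "finite K"
  shows "coord (ell2_on K h) j = (if j \<in> K then h j else 0)"
proof -
  have "summable (\<lambda>j. (if j \<in> K then h j else 0)\<^sup>2)"
    by (rule summable_finite[OF assms]) simp
  then show ?thesis
    unfolding ell2_on_def by (subst Abs_ell2_inverse) auto
qed

lemma inner_ell2_on:
  assumes "finite K"
  shows "v \<bullet> ell2_on K h = (\<Sum>j\<in>K. coord v j * h j)"
  unfolding inner_ell2_def using assms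
  by (subst suminf_finite[of K]) (auto simp: coord_ell2_on)

lemma bounded_linear_coord: "bounded_linear (\<lambda>x. coord x n)"
  by (rule bounded_linear_intro[of _ 1]) (simp_all add: abs_coord_le_norm)

lemma coord_sum: "coord (\<Sum>i\<in>A. g i) n = (\<Sum>i\<in>A. coord (g i) n)"
  by (rule bounded_linear.linear[OF bounded_linear_coord, THEN linear_sum])

lemma sum_square_coord_le_norm_finite:
  assumes "finite K"
  shows "(\<Sum>n\<in>K. (coord x n)\<^sup>2) \<le> (norm x)\<^sup>2"
  unfolding power2_norm_ell2 using assms
  by (intro sum_le_suminf summable_square_coord) auto

section \<open>Separability and infinite dimension of \<open>ell2\<close>\<close>

lemma ell2_partial_sums_tendsto:
  "(\<lambda>N. \<Sum>n<N. coord v n *\<^sub>R ell2_on {n} (\<lambda>_. 1)) \<longlonglongrightarrow> v"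
proof -
  let ?P = "\<lambda>N. \<Sum>n<N. coord v n *\<^sub>R ell2_on {n} (\<lambda>_. 1)"
  let ?h = "\<lambda>n. (coord v n)\<^sup>2"
  have c: "coord (?P N) j = (if j < N then coord v j else 0)" for N j
    by (simp add: coord_sum coord_ell2_on if_distrib cong: if_cong)
  \<comment> \<open>The squared distance from \<open>v\<close> to its truncation is the tail of a
    convergent series.\<close>
  have "(norm (?P N - v))\<^sup>2 = suminf ?h - (\<Sum>n<N. ?h n)" for N
  proof -
    have s: "(\<lambda>n. if n \<in> {..<N} then ?h n else 0) sums (\<Sum>n<N. ?h n)"
      by (rule sums_If_finite_set) simp
    have "(norm (?P N - v))\<^sup>2 = (\<Sum>n. ?h n - (if n \<in> {..<N} then ?h n else 0))"
      unfolding power2_norm_ell2 by (rule suminf_cong) (simp add: c)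
    also have "\<dots> = suminf ?h - (\<Sum>n<N. ?h n)"
      using suminf_diff[OF summable_square_coord sums_summable[OF s]] sums_unique[OF s] by simp
    finally show ?thesis .
  qed
  moreover have "(\<lambda>N. suminf ?h - (\<Sum>n<N. ?h n)) \<longlonglongrightarrow> suminf ?h - suminf ?h"
    by (intro tendsto_intros summable_LIMSEQ summable_square_coord)
  ultimately have "(\<lambda>N. (norm (?P N - v))\<^sup>2) \<longlonglongrightarrow> 0"
    by simp
  then have "(\<lambda>N. sqrt ((norm (?P N - v))\<^sup>2)) \<longlonglongrightarrow> sqrt 0"
    by (rule tendsto_real_sqrt)
  then have "(\<lambda>N. norm (?P N - v)) \<longlonglongrightarrow> 0"
    by simp
  then show ?thesis
    by (rule LIM_zero_cancel[OF tendsto_norm_zero_cancel])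
qed

text \<open>Finite rational combinations of unit vectors are dense, in two stages: rational
  coefficients approximate a truncation of \<open>v\<close>, and truncations approximate
  \<open>v\<close>. Lists of rationals form the countable index set.\<close>

lemma separable_space_ell2: "separable_space (euclidean :: ell2 topology)"
proof -
  define \<phi> :: "rat list \<Rightarrow> ell2"
    where "\<phi> l = (\<Sum>n<length l. real_of_rat (l ! n) *\<^sub>R ell2_on {n} (\<lambda>_. 1))" for l
  have "v \<in> closure (range \<phi>)" for v
  proof -
    have "\<forall>n m. \<exists>q. dist (real_of_rat q) (coord v n) < inverse (real (Suc m))"
    proof (intro allI)
      fix n m
      obtain q where "coord v n < real_of_rat q"
          "real_of_rat q < coord v n + inverse (real (Suc m))"
        using of_rat_dense[of "coord v n" "coord v n + inverse (real (Suc m))"] by auto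
      then show "\<exists>q. dist (real_of_rat q) (coord v n) < inverse (real (Suc m))"
        by (intro exI[of _ q]) (simp add: dist_real_def)
    qed
    then obtain q where
      q: "\<And>n m. dist (real_of_rat (q n m)) (coord v n) < inverse (real (Suc m))"
      unfolding choice_iff by blast
    have qlim: "(\<lambda>m. real_of_rat (q n m)) \<longlonglongrightarrow> coord v n" for n
      by (rule metric_tendsto_imp_tendsto[OF LIMSEQ_inverse_real_of_nat])
        (use q[of n] in \<open>simp add: dist_real_def less_imp_le\<close>)
    have "(\<Sum>n<N. coord v n *\<^sub>R ell2_on {n} (\<lambda>_. 1)) \<in> closure (range \<phi>)" for N
    proof -
      have lim: "(\<lambda>m. \<phi> (map (\<lambda>n. q n m) [0..<N])) \<longlonglongrightarrow>
          (\<Sum>n<N. coord v n *\<^sub>R ell2_on {n} (\<lambda>_. 1))"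
        unfolding \<phi>_def by (auto intro!: tendsto_intros qlim)
      show ?thesis
        unfolding closure_sequential
        by (rule exI[of _ "\<lambda>m. \<phi> (map (\<lambda>n. q n m) [0..<N])"]) (use lim in simp)
    qed
    then show ?thesis
      by (rule closed_sequentially[OF closed_closure _ ell2_partial_sums_tendsto])
  qed
  then have "closure (range \<phi>) = UNIV"
    by blast
  then show ?thesis
    unfolding separable_space_def by (intro exI[of _ "range \<phi>"]) simp
qed

text \<open>The unit vectors form an infinite orthogonal, hence independent, family, whereas a
  finite spanning set bounds the size of independent sets.\<close>

lemma ell2_not_finitely_spanned: "\<not> (\<exists>S :: ell2 set. finite S \<and> span S = UNIV)"
proof
  assume "\<exists>S :: ell2 set. finite S \<and> span S = UNIV"
  then obtain S :: "ell2 set" where S: "finite S" "span S = UNIV"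
    by blast
  define e :: "nat \<Rightarrow> ell2" where "e n = ell2_on {n} (\<lambda>_. 1)" for n
  have ce: "coord (e n) j = (if j = n then 1 else 0)" for n j
    by (simp add: e_def coord_ell2_on)
  have "inj e"
    by (rule injI) (metis ce zero_neq_one)
  have "pairwise orthogonal (range e)"
    by (auto simp: pairwise_def orthogonal_def e_def inner_ell2_on coord_ell2_on)
  moreover have "0 \<notin> range e"
    by (metis ce coord_0 rangeE zero_neq_one)
  ultimately have "independent (range e)"
    by (rule pairwise_orthogonal_independent)
  then have "finite (range e)"
    using independent_span_bound[OF S(1)] S(2) by blast
  with \<open>inj e\<close> show False
    using finite_imageD by blast
qed

section \<open>A frame with one linear relation in each block\<close>

text \<open>Exponential growth of the blocks makes \<open>b\<close> summable. The exact third in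
  \<open>block_cut\<close> fixes how much of a block's relation a cut has taken up, and size at
  least 12 keeps the lower-order terms of the resulting estimate small.\<close>

locale interleaved_blocks =
  fixes blk :: "nat \<Rightarrow> nat"
  assumes card_block: "2 ^ m \<le> card {i. blk i = m}"
    and block_cut: "\<exists>\<tau>\<^sub>0. \<forall>\<tau>\<ge>\<tau>\<^sub>0. \<exists>m. 12 \<le> card {i. blk i = m} \<and>
        3 * card {i. blk i = m \<and> i < \<tau>} = card {i. blk i = m}"
begin

definition K :: "nat \<Rightarrow> nat set" where
  "K m = {i. blk i = m}"

definition d :: "nat \<Rightarrow> real" where
  "d m = real (card (K m))"

definition b :: "nat \<Rightarrow> real" where
  "b m = 1 / sqrt (d m)"

text \<open>With a d = 1 + b the vectors e_i - a 1_K sum to -b 1_K, which the extra vector b 1_K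
  cancels.\<close>

definition a :: "nat \<Rightarrow> real" where
  "a m = (1 + b m) / d m"

text \<open>Even indices list the vectors e_i - a 1_K in the order of their coordinates, odd indices
  one vector b 1_K per block. Up to the odd vectors, a cut of the sequence is thus a cut of the
  coordinates.\<close>

definition x :: "nat \<Rightarrow> ell2" where
  "x p = (if even p
     then ell2_on (K (blk (p div 2))) (\<lambda>j. (if j = p div 2 then 1 else 0) - a (blk (p div 2)))
     else ell2_on (K (p div 2)) (\<lambda>j. b (p div 2)))"

definition pblk :: "nat \<Rightarrow> nat" where
  "pblk p = (if even p then blk (p div 2) else p div 2)"

definition Q :: "nat \<Rightarrow> nat set" where
  "Q m = {p. pblk p = m}"

lemma mem_K: "j \<in> K m \<longleftrightarrow> blk j = m"
  by (simp add: K_def)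

lemma mem_Q: "p \<in> Q m \<longleftrightarrow> pblk p = m"
  by (simp add: Q_def)

lemma card_K_pos: "0 < card (K m)"
  using card_block[of m] unfolding K_def
  by (metis less_le_trans zero_less_numeral zero_less_power)

lemma finite_K [simp]: "finite (K m)"
  using card_K_pos card_ge_0_finite by blast

lemma d_ge: "2 ^ m \<le> d m"
  using card_block[of m] unfolding d_def K_def by (metis of_nat_le_iff of_nat_numeral of_nat_power)

lemma d_pos: "0 < d m"
  using card_K_pos by (simp add: d_def)

lemma b_pos: "0 < b m"
  using d_pos by (simp add: b_def)

lemma b_square: "(b m)\<^sup>2 = 1 / d m"
  using d_pos[of m] by (simp add: b_def power_divide)

lemma a_times_d: "a m * d m = 1 + b m"
  using d_pos[of m] by (simp add: a_def)

lemma Q_eq: "Q m = insert (2 * m + 1) ((\<lambda>i. 2 * i) ` K m)"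
proof (intro equalityI subsetI)
  fix p assume "p \<in> Q m"
  then show "p \<in> insert (2 * m + 1) ((\<lambda>i. 2 * i) ` K m)"
    by (cases "even p") (auto simp: mem_Q pblk_def mem_K elim!: evenE oddE)
qed (auto simp: mem_Q pblk_def mem_K)

lemma finite_Q [simp]: "finite (Q m)"
  by (simp add: Q_eq)

lemma Q_nonempty: "Q m \<noteq> {}"
  by (simp add: Q_eq)

lemma sum_Q: "(\<Sum>p\<in>Q m. h p) = h (2 * m + 1) + (\<Sum>i\<in>K m. h (2 * i))"
proof -
  have "2 * m + 1 \<notin> (\<lambda>i. 2 * i) ` K m"
    by (auto; presburger)
  then have "(\<Sum>p\<in>Q m. h p) = h (2 * m + 1) + sum h ((\<lambda>i. 2 * i) ` K m)"
    by (simp add: Q_eq)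
  also have "sum h ((\<lambda>i. 2 * i) ` K m) = (\<Sum>i\<in>K m. h (2 * i))"
    by (subst sum.reindex) (auto simp: inj_on_def)
  finally show ?thesis .
qed

lemma coord_x: "coord (x p) j =
  (if blk j = pblk p then if even p then (if j = p div 2 then 1 else 0) - a (pblk p) else b (pblk p)
   else 0)"
  by (simp add: x_def pblk_def coord_ell2_on mem_K)

section \<open>Frame bounds\<close>

lemma inner_x_even: "v \<bullet> x (2 * i) = coord v i - a (blk i) * (\<Sum>j\<in>K (blk i). coord v j)"
proof -
  have "v \<bullet> x (2 * i) = (\<Sum>j\<in>K (blk i). (if j = i then coord v i else 0) - a (blk i) * coord v j)"
    by (simp add: x_def inner_ell2_on) (rule sum.cong, auto simp: algebra_simps)
  also have "\<dots> = (\<Sum>j\<in>K (blk i). (if j = i then coord v i else 0))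
      - a (blk i) * (\<Sum>j\<in>K (blk i). coord v j)"
    by (simp only: sum_subtractf sum_distrib_left)
  also have "(\<Sum>j\<in>K (blk i). (if j = i then coord v i else 0)) = coord v i"
    by (simp add: mem_K)
  finally show ?thesis .
qed

lemma inner_x_odd: "v \<bullet> x (2 * m + 1) = b m * (\<Sum>j\<in>K m. coord v j)"
  by (simp add: x_def inner_ell2_on sum_distrib_left mult.commute)

text \<open>Expanding the squares gives S + sigma^2 (b^2 - 2 a + d a^2), and a d = 1 + b together
  with b^2 = 1 / d collapses the factor to 1 / d^2. On a block the frame operator is therefore the
  identity plus a small rank-one term.\<close>

lemma sum_square_inner_block:
  "(\<Sum>p\<in>Q m. (v \<bullet> x p)\<^sup>2) =
     (\<Sum>j\<in>K m. (coord v j)\<^sup>2) + (\<Sum>j\<in>K m. coord v j)\<^sup>2 / (d m)\<^sup>2"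
proof -
  define \<sigma> where "\<sigma> = (\<Sum>j\<in>K m. coord v j)"
  define S where "S = (\<Sum>j\<in>K m. (coord v j)\<^sup>2)"
  have "(\<Sum>i\<in>K m. (v \<bullet> x (2 * i))\<^sup>2) =
      (\<Sum>i\<in>K m. (coord v i)\<^sup>2 - 2 * a m * \<sigma> * coord v i + (a m * \<sigma>)\<^sup>2)"
    by (rule sum.cong)
      (auto simp: inner_x_even mem_K \<sigma>_def power2_diff simp del: power_mult_distrib)
  also have "\<dots> = S - 2 * a m * \<sigma> * \<sigma> + d m * (a m * \<sigma>)\<^sup>2"
    by (simp add: sum.distrib sum_subtractf S_def \<sigma>_def d_def flip: sum_distrib_left)
  finally have *: "(\<Sum>p\<in>Q m. (v \<bullet> x p)\<^sup>2) =
      S + \<sigma>\<^sup>2 * ((b m)\<^sup>2 - 2 * a m + d m * (a m)\<^sup>2)"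
    by (simp only: sum_Q inner_x_odd \<sigma>_def[symmetric])
      (simp add: algebra_simps power2_eq_square)
  have "d m * ((b m)\<^sup>2 - 2 * a m + d m * (a m)\<^sup>2) =
      d m * (b m)\<^sup>2 - 2 * (a m * d m) + (a m * d m)\<^sup>2"
    by (simp add: algebra_simps power2_eq_square)
  also have "\<dots> = 1 / d m"
    using d_pos[of m] unfolding a_times_d
    by (simp add: power2_sum b_square)
  finally have "(b m)\<^sup>2 - 2 * a m + d m * (a m)\<^sup>2 = 1 / (d m)\<^sup>2"
    using d_pos[of m] by (simp add: field_simps power2_eq_square)
  then show ?thesis
    using * by (simp add: S_def \<sigma>_def)
qed

lemma sum_square_inner_block_ge:
  "(\<Sum>j\<in>K m. (coord v j)\<^sup>2) \<le> (\<Sum>p\<in>Q m. (v \<bullet> x p)\<^sup>2)"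
  by (simp add: sum_square_inner_block)

text \<open>By Cauchy-Schwarz the squared sum of the coordinates is at most d times their sum of
  squares, and \<open>1 \<le> d m\<close>.\<close>

lemma sum_square_inner_block_le:
  "(\<Sum>p\<in>Q m. (v \<bullet> x p)\<^sup>2) \<le> 2 * (\<Sum>j\<in>K m. (coord v j)\<^sup>2)"
proof -
  define S where "S = (\<Sum>j\<in>K m. (coord v j)\<^sup>2)"
  have S: "0 \<le> S"
    by (simp add: S_def sum_nonneg)
  have d1: "1 \<le> d m"
    using d_ge[of m] by (rule order_trans[rotated]) simp
  have "(\<Sum>j\<in>K m. coord v j)\<^sup>2 \<le> S * d m"
    unfolding S_def d_def by (rule sum_squared_le_sum_of_squares)
  also have "\<dots> \<le> S * (d m)\<^sup>2"
    using d1 S by (intro mult_left_mono) (auto simp: power2_eq_square)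
  finally show ?thesis
    using d1 by (simp add: sum_square_inner_block S_def[symmetric] divide_le_eq)
qed

lemma sum_blocks:
  fixes h :: "nat \<Rightarrow> 'a :: comm_monoid_add"
  shows "(\<Sum>m<M. \<Sum>i\<in>K m. h i) = sum h (\<Union>m<M. K m)"
    and "(\<Sum>m<M. \<Sum>p\<in>Q m. h p) = sum h (\<Union>m<M. Q m)"
  by (rule sum.UNION_disjoint[symmetric]; auto simp: mem_K mem_Q)+

text \<open>Enlarges finite sums to sums over whole blocks; the common \<open>M\<close> lets
  coordinates and frame vectors be compared block by block.\<close>

lemma finite_subset_blocks:
  assumes "finite F"
  obtains M where "F \<subseteq> (\<Union>m<M. K m)" "F \<subseteq> (\<Union>m<M. Q m)"
proof -
  obtain M where M: "blk ` F \<union> pblk ` F \<subseteq> {..<M}"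
    using assms finite_nat_iff_bounded[of "blk ` F \<union> pblk ` F"] by auto
  show thesis
    by (rule that[of M]) (use M in \<open>auto simp: mem_K mem_Q\<close>)
qed

lemma bessel_x_finite:
  assumes "finite F"
  shows "(\<Sum>p\<in>F. (v \<bullet> x p)\<^sup>2) \<le> 2 * (norm v)\<^sup>2"
proof -
  obtain M where M: "F \<subseteq> (\<Union>m<M. K m)" "F \<subseteq> (\<Union>m<M. Q m)"
    by (rule finite_subset_blocks[OF assms])
  have "(\<Sum>p\<in>F. (v \<bullet> x p)\<^sup>2) \<le> (\<Sum>p\<in>(\<Union>m<M. Q m). (v \<bullet> x p)\<^sup>2)"
    using M by (intro sum_mono2) auto
  also have "\<dots> \<le> (\<Sum>m<M. 2 * (\<Sum>j\<in>K m. (coord v j)\<^sup>2))"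
    unfolding sum_blocks[symmetric] by (intro sum_mono sum_square_inner_block_le)
  also have "\<dots> = 2 * (\<Sum>j\<in>(\<Union>m<M. K m). (coord v j)\<^sup>2)"
    unfolding sum_blocks[symmetric] by (simp add: sum_distrib_left)
  also have "\<dots> \<le> 2 * (norm v)\<^sup>2"
    by (intro mult_left_mono sum_square_coord_le_norm_finite) auto
  finally show ?thesis .
qed

lemma frame_x: "frame x"
  unfolding frame_def
proof (rule exI[of _ 1], rule exI[of _ 2], intro conjI allI)
  fix v
  show s: "summable (\<lambda>j. \<bar>v \<bullet> x j\<bar>\<^sup>2)"
    using bessel_x_finite by (intro summableI_nonneg_bounded) auto
  show "(\<Sum>j. \<bar>v \<bullet> x j\<bar>\<^sup>2) \<le> 2 * (norm v)\<^sup>2"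
    using bessel_x_finite s by (intro suminf_le_const) auto
  have "(\<Sum>i<k. (coord v i)\<^sup>2) \<le> (\<Sum>j. \<bar>v \<bullet> x j\<bar>\<^sup>2)" for k
  proof -
    obtain M where M: "{..<k} \<subseteq> (\<Union>m<M. K m)" "{..<k} \<subseteq> (\<Union>m<M. Q m)"
      by (rule finite_subset_blocks[OF finite_lessThan])
    have "(\<Sum>i<k. (coord v i)\<^sup>2) \<le> (\<Sum>i\<in>(\<Union>m<M. K m). (coord v i)\<^sup>2)"
      using M by (intro sum_mono2) auto
    also have "\<dots> \<le> (\<Sum>p\<in>(\<Union>m<M. Q m). (v \<bullet> x p)\<^sup>2)"
      unfolding sum_blocks[symmetric] by (intro sum_mono sum_square_inner_block_ge)
    also have "\<dots> \<le> (\<Sum>j. \<bar>v \<bullet> x j\<bar>\<^sup>2)"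
      using s by (subst power2_abs[symmetric], intro sum_le_suminf) auto
    finally show ?thesis .
  qed
  then show "1 * (norm v)\<^sup>2 \<le> (\<Sum>j. \<bar>v \<bullet> x j\<bar>\<^sup>2)"
    unfolding power2_norm_ell2 mult_1 by (intro suminf_le_const summable_square_coord)
qed auto

text \<open>Bessel's inequality applied to \<open>x p\<close> itself bounds the fourth power of its
  norm by twice the square.\<close>

lemma norm_x_le: "norm (x p) \<le> 2"
proof (rule ccontr)
  assume "\<not> norm (x p) \<le> 2"
  then have *: "2\<^sup>2 < (norm (x p))\<^sup>2"
    by (intro power_strict_mono) auto
  have "(norm (x p))\<^sup>2 * (norm (x p))\<^sup>2 \<le> 2 * (norm (x p))\<^sup>2"
    using bessel_x_finite[of "{p}" "x p"]
    by (simp add: power2_norm_eq_inner power2_eq_square[of "x p \<bullet> x p"])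
  then have "(norm (x p))\<^sup>2 \<le> 2"
    using * by (subst (asm) mult_le_cancel_right) auto
  with * show False
    by simp
qed

section \<open>The linear relations inside a block\<close>

lemma block_relation: "(\<Sum>p\<in>Q m. x p) = 0"
proof (rule ell2_eqI)
  fix j
  have "(\<Sum>i\<in>K m. coord (x (2 * i)) j) =
      (if blk j = m then (\<Sum>i\<in>K m. (if j = i then 1 else 0) - a m) else 0)"
    by (auto simp: coord_x pblk_def mem_K intro!: sum.cong)
  also have "\<dots> = (if blk j = m then 1 - a m * d m else 0)"
    by (auto simp: sum_subtractf d_def mem_K)
  finally show "coord (\<Sum>p\<in>Q m. x p) j = coord 0 j"
    by (auto simp: coord_sum sum_Q coord_x pblk_def a_times_d)
qed

text \<open>Coordinate \<open>j\<close> of the relation says that \<open>\<beta> (2 * j)\<close>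
  equals a quantity \<open>C\<close> independent of \<open>j\<close>. Substituting this into
  \<open>C\<close> gives C = (1 + b) C - b \<open>\<beta> (2 * m + 1)\<close>, so the remaining
  coefficient is \<open>C\<close> as well.\<close>

lemma block_relation_unique:
  assumes rel: "\<And>j. j \<in> K m \<Longrightarrow> (\<Sum>p\<in>Q m. \<beta> p * coord (x p) j) = 0"
    and "p \<in> Q m" "q \<in> Q m"
  shows "\<beta> p = \<beta> q"
proof -
  define C where "C = a m * (\<Sum>i\<in>K m. \<beta> (2 * i)) - \<beta> (2 * m + 1) * b m"
  have even: "\<beta> (2 * j) = C" if "j \<in> K m" for j
  proof -
    have "(\<Sum>i\<in>K m. \<beta> (2 * i) * coord (x (2 * i)) j)
        = (\<Sum>i\<in>K m. (if i = j then \<beta> (2 * j) else 0) - a m * \<beta> (2 * i))"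
      using that by (intro sum.cong) (auto simp: coord_x pblk_def mem_K algebra_simps)
    also have "\<dots> = \<beta> (2 * j) - a m * (\<Sum>i\<in>K m. \<beta> (2 * i))"
      using that by (simp add: sum_subtractf sum_distrib_left)
    finally show ?thesis
      using rel[OF that] that by (simp add: sum_Q coord_x pblk_def mem_K C_def)
  qed
  have "(\<Sum>i\<in>K m. \<beta> (2 * i)) = d m * C"
    by (simp add: even d_def)
  then have "C = (a m * d m) * C - \<beta> (2 * m + 1) * b m"
    by (metis C_def mult.assoc)
  then have "b m * \<beta> (2 * m + 1) = b m * C"
    unfolding a_times_d by (simp add: algebra_simps)
  then have "\<beta> (2 * m + 1) = C"
    using b_pos[of m] by simp
  then have "\<beta> p = C" if "p \<in> Q m" for p
    using that even by (auto simp: Q_eq)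
  then show ?thesis
    using assms by simp
qed

lemma summable_b: "summable b"
proof (rule summable_comparison_test')
  show "summable (\<lambda>m. (1 / sqrt 2) ^ m)"
    by (rule summable_geometric) auto
  fix m
  have "sqrt 2 ^ m \<le> sqrt (d m)"
    using d_ge[of m] by (metis real_sqrt_le_iff real_sqrt_power)
  then show "norm (b m) \<le> (1 / sqrt 2) ^ m"
    using d_pos[of m] by (simp add: b_def power_divide frac_le)
qed

section \<open>Failure of bracket expansions\<close>

text \<open>By the block relation, the indicator of a fully selected block would expand 0, besides
  the zero sequence.\<close>

lemma subsequence_misses_block:
  assumes r: "strict_mono r" and N: "strict_mono N"
    and unique: "\<exists>!\<alpha> :: nat \<Rightarrow> real. (\<lambda>j. \<Sum>q<N j. \<alpha> q *\<^sub>R x (r q)) \<longlonglongrightarrow> 0"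
  shows "\<not> Q m \<subseteq> range r"
proof
  assume sub: "Q m \<subseteq> range r"
  define F where "F = r -` Q m"
  have inj: "inj r"
    using r strict_mono_imp_inj_on by blast
  have F: "finite F" "r ` F = Q m"
    using sub inj by (auto simp: F_def finite_vimageI)
  define \<alpha> where "\<alpha> q = (if q \<in> F then 1 else 0 :: real)" for q
  obtain B where B: "F \<subseteq> {..<B}"
    using F(1) finite_nat_iff_bounded by blast
  have "(\<Sum>q<N j. \<alpha> q *\<^sub>R x (r q)) = 0" if "B \<le> j" for j
  proof -
    \<comment> \<open>Since \<open>j \<le> N j\<close>, late brackets contain the whole
      block.\<close>
    have "F \<subseteq> {..<N j}"
      using B that seq_suble[OF N, of j] by fastforce
    then have "(\<Sum>q<N j. \<alpha> q *\<^sub>R x (r q)) = (\<Sum>q\<in>F. x (r q))"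
      by (intro sum.mono_neutral_cong_right) (auto simp: \<alpha>_def)
    also have "\<dots> = (\<Sum>p\<in>Q m. x p)"
      using F(2) inj by (metis inj_on_subset subset_UNIV sum.reindex_cong)
    finally show ?thesis
      by (simp add: block_relation)
  qed
  then have "(\<lambda>j. \<Sum>q<N j. \<alpha> q *\<^sub>R x (r q)) \<longlonglongrightarrow> 0"
    by (intro tendsto_eventually eventually_sequentiallyI)
  moreover have "(\<lambda>j. \<Sum>q<N j. (0 :: real) *\<^sub>R x (r q)) \<longlonglongrightarrow> 0"
    by simp
  ultimately have "\<alpha> = (\<lambda>_. 0)"
    by (rule Uniq_D[OF unique[unfolded ex1_iff_ex_Uniq, THEN conjunct2]])
  moreover have "F \<noteq> {}"
    using F(2) Q_nonempty[of m] by blast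
  ultimately show False
    unfolding \<alpha>_def by (metis ex_in_conv zero_neq_one)
qed

text \<open>Coordinate \<open>j\<close> receives 1 from the e_j in \<open>x (2 * j)\<close>, -a from
  every even vector in \<open>W\<close>, and at least 0 from an odd one. There are at most d / 3 + 1
  even vectors, and a (d / 3 + 1) is at most 5 / 9 once d is at least 12.\<close>

lemma cut_block_coord_ge:
  assumes m: "12 \<le> card (K m)" "3 * card {i. blk i = m \<and> i < \<tau>} = card (K m)"
    and W: "W = insert k {p \<in> Q m. p < T}" "k \<in> Q m" and \<tau>: "\<And>i. 2 * i < T \<longleftrightarrow> i < \<tau>"
    and j: "j \<in> K m" "j < \<tau>"
  shows "1 / 4 \<le> (\<Sum>p\<in>W. coord (x p) j)"
proof -
  define A where "A = {i. blk i = m \<and> i < \<tau>}"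
  define E where "E = {p \<in> W. even p}"
  have finW: "finite W"
    using W by simp
  \<comment> \<open>The vector \<open>k\<close> may be even and lie beyond the cut, hence the 1
    added to \<open>card A\<close>.\<close>
  have "E \<subseteq> insert k ((\<lambda>i. 2 * i) ` A)"
    using \<tau> by (auto simp: E_def W mem_Q pblk_def A_def elim!: evenE)
  then have "card E \<le> card (insert k ((\<lambda>i. 2 * i) ` A))"
    by (rule card_mono[rotated]) (simp add: A_def)
  also have "\<dots> \<le> Suc (card ((\<lambda>i. 2 * i) ` A))"
    by (rule card_insert_le_m1) auto
  also have "\<dots> \<le> Suc (card A)"
    by (simp add: card_image_le A_def)
  finally have "real (card E) \<le> real (card A) + 1"
    by simp
  moreover have "3 * real (card A) = d m"
    using m(2) unfolding A_def d_def by linarith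
  ultimately have cardE: "card E \<le> d m / 3 + 1"
    by linarith
  have d12: "12 \<le> d m"
    using m(1) by (simp add: d_def)
  have "b m \<le> 1 / 3"
  proof -
    have "3 \<le> sqrt (d m)"
      using d12 by (intro real_le_rsqrt) auto
    then show ?thesis
      using d12 by (simp add: b_def divide_le_eq)
  qed
  have "a m * card E \<le> (1 + b m) / d m * (d m / 3 + 1)"
    unfolding a_def using cardE b_pos[of m] d_pos[of m]
    by (intro mult_left_mono) auto
  also have "\<dots> = (1 + b m) * (1 / 3 + 1 / d m)"
    using d_pos[of m] by (simp add: field_simps)
  also have "\<dots> \<le> (4 / 3) * (1 / 3 + 1 / 12)"
    using \<open>b m \<le> 1 / 3\<close> d12 b_pos[of m]
    by (intro mult_mono add_mono) (auto simp: frac_le)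
  finally have aE: "a m * card E \<le> 5 / 9"
    by simp
  have WQ: "pblk p = m" if "p \<in> W" for p
    using that W by (auto simp: mem_Q)
  have jW: "2 * j \<in> W"
    using j \<tau> by (auto simp: W mem_Q pblk_def mem_K)
  have "(\<Sum>p\<in>W. (if p = 2 * j then 1 else 0) - (if even p then a m else 0)) \<le>
      (\<Sum>p\<in>W. coord (x p) j)"
    using j b_pos[of m] by (intro sum_mono) (auto simp: coord_x WQ mem_K less_imp_le)
  moreover have "(\<Sum>p\<in>W. (if p = 2 * j then 1 else 0) - (if even p then a m else 0))
      = 1 - a m * card E"
    using jW finW by (simp add: sum_subtractf E_def sum.If_cases Int_def mult.commute)
  ultimately show ?thesis
    using aE by simp
qed

text \<open>In the application \<open>y\<close> is the error of a partial sum. A third of the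
  block's d coordinates have modulus at least b / 4, and b^2 = 1 / d, so the bound is (d / 3) (b^2 /
  16) = 1 / 48.\<close>

lemma cut_block_norm_ge:
  assumes m: "12 \<le> card (K m)" "3 * card {i. blk i = m \<and> i < \<tau>} = card (K m)"
    and W: "W = insert k {p \<in> Q m. p < T}" "k \<in> Q m" and \<tau>: "\<And>i. 2 * i < T \<longleftrightarrow> i < \<tau>"
    and y: "\<And>j. j \<in> K m \<Longrightarrow> coord y j = - b m * (\<Sum>p\<in>W. coord (x p) j)"
  shows "1 / 48 \<le> (norm y)\<^sup>2"
proof -
  define A where "A = {i. blk i = m \<and> i < \<tau>}"
  have A: "A \<subseteq> K m" "finite A" and cardA: "real (card A) = d m / 3"
    using m(2) by (auto simp: A_def K_def d_def)
  have "(b m / 4)\<^sup>2 \<le> (coord y j)\<^sup>2" if "j \<in> A" for j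
  proof -
    have "1 / 4 \<le> (\<Sum>p\<in>W. coord (x p) j)"
      using that by (intro cut_block_coord_ge[OF m W \<tau>]) (auto simp: A_def mem_K)
    then have "b m * (1 / 4) \<le> b m * (\<Sum>p\<in>W. coord (x p) j)"
      using b_pos[of m] by (intro mult_left_mono) auto
    then show ?thesis
      using b_pos[of m] that A(1) y[of j] by (auto simp: abs_le_square_iff[symmetric])
  qed
  then have "card A * (b m / 4)\<^sup>2 \<le> (\<Sum>j\<in>A. (coord y j)\<^sup>2)"
    using sum_bounded_below[of A "(b m / 4)\<^sup>2" "\<lambda>j. (coord y j)\<^sup>2"] by auto
  also have "\<dots> \<le> (norm y)\<^sup>2"
    using A(2) by (rule sum_square_coord_le_norm_finite)
  finally show ?thesis
    using d_pos[of m] by (simp add: cardA power_divide b_square)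
qed

lemma no_basis_with_brackets:
  assumes r: "strict_mono r"
  shows "\<not> basis_with_brackets (x \<circ> r)"
proof
  assume "basis_with_brackets (x \<circ> r)"
  then obtain N :: "nat \<Rightarrow> nat" where N: "strict_mono N"
    and ex1: "\<And>v. \<exists>!\<alpha> :: nat \<Rightarrow> real. (\<lambda>j. \<Sum>q<N j. \<alpha> q *\<^sub>R x (r q)) \<longlonglongrightarrow> v"
    unfolding basis_with_brackets_def comp_def by blast
  have "\<forall>m. \<exists>k. k \<in> Q m \<and> k \<notin> range r"
    using subsequence_misses_block[OF r N ex1] by blast
  then obtain k where k: "\<And>m. k m \<in> Q m" "\<And>m. k m \<notin> range r"
    by metis
  \<comment> \<open>The weights \<open>b m\<close> are small enough for absolute convergence, yet
    balance the growth of order sqrt d of the partial sums, so that the error in each cut block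
    keeps a fixed size.\<close>
  define v where "v = (\<Sum>m. b m *\<^sub>R x (k m))"
  have sv: "summable (\<lambda>m. b m *\<^sub>R x (k m))"
  proof (rule summable_comparison_test')
    show "summable (\<lambda>m. 2 * b m)"
      using summable_b by (rule summable_mult)
    show "norm (b m *\<^sub>R x (k m)) \<le> 2 * b m" for m
      using norm_x_le[of "k m"] b_pos[of m] by (simp add: mult.commute mult_left_mono)
  qed
  have coord_v: "coord v j = b m * coord (x (k m)) j" if "j \<in> K m" for j m
  proof -
    have "coord v j = (\<Sum>n. coord (b n *\<^sub>R x (k n)) j)"
      unfolding v_def by (rule bounded_linear.suminf[OF bounded_linear_coord sv])
    also have "\<dots> = (\<Sum>n\<in>{m}. coord (b n *\<^sub>R x (k n)) j)"
      using k(1) that by (intro suminf_finite) (auto simp: coord_x mem_Q mem_K)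
    finally show ?thesis
      by simp
  qed
  obtain \<alpha> :: "nat \<Rightarrow> real" where \<alpha>: "(\<lambda>j. \<Sum>q<N j. \<alpha> q *\<^sub>R x (r q)) \<longlonglongrightarrow> v"
    using ex1[of v] by blast
  define S where "S t = (\<Sum>q<t. \<alpha> q *\<^sub>R x (r q))" for t
  have inj: "inj r"
    using r strict_mono_imp_inj_on by blast
  \<comment> \<open>Coefficients move to the indices of the full frame, with 0 at omitted vectors,
    so that an initial segment of the subsequence becomes one of the frame.\<close>
  define \<beta> where "\<beta> p = (if p \<in> range r then \<alpha> (inv r p) else 0)" for p
  have \<beta>k: "\<beta> (k m) = 0" for m
    using k(2) by (simp add: \<beta>_def)
  have S: "coord (S t) j = (\<Sum>p | p \<in> Q m \<and> p < r t. \<beta> p * coord (x p) j)"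
    if "j \<in> K m" for t j m
  proof -
    have "coord (S t) j = (\<Sum>q<t. \<beta> (r q) * coord (x (r q)) j)"
      by (simp add: S_def coord_sum \<beta>_def inj)
    also have "\<dots> = (\<Sum>p\<in>r ` {..<t}. \<beta> p * coord (x p) j)"
      using inj by (subst sum.reindex) (auto simp: inj_on_def)
    also have "\<dots> = (\<Sum>p<r t. \<beta> p * coord (x p) j)"
      using r by (intro sum.mono_neutral_left) (auto simp: \<beta>_def strict_mono_less)
    also have "\<dots> = (\<Sum>p | p \<in> Q m \<and> p < r t. \<beta> p * coord (x p) j)"
      using that by (intro sum.mono_neutral_right) (auto simp: coord_x mem_Q mem_K)
    finally show ?thesis .
  qed
  have \<beta>: "\<beta> p = - b m" if p: "p \<in> Q m" "p \<noteq> k m" for p m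
  proof -
    \<comment> \<open>Once a bracket has passed the block, the coordinate no longer changes and so
      equals its limit.\<close>
    have coef: "(\<Sum>p\<in>Q m. \<beta> p * coord (x p) j) = coord v j" if j: "j \<in> K m" for j
    proof (rule LIMSEQ_unique)
      show "(\<lambda>t. coord (S (N t)) j) \<longlonglongrightarrow> coord v j"
        using \<alpha> unfolding S_def by (rule bounded_linear.tendsto[OF bounded_linear_coord])
      obtain B where B: "Q m \<subseteq> {..<B}"
        using finite_nat_iff_bounded[of "Q m"] by auto
      have "coord (S (N t)) j = (\<Sum>p\<in>Q m. \<beta> p * coord (x p) j)" if "B \<le> t" for t
      proof -
        have "B \<le> r (N t)"
          using that seq_suble[OF N, of t] seq_suble[OF r, of "N t"] by linarith
        then have "{p. p \<in> Q m \<and> p < r (N t)} = Q m"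
          using B by auto
        then show ?thesis
          using S[OF j] by simp
      qed
      then show "(\<lambda>t. coord (S (N t)) j) \<longlonglongrightarrow> (\<Sum>p\<in>Q m. \<beta> p * coord (x p) j)"
        by (intro tendsto_eventually eventually_sequentiallyI)
    qed
    \<comment> \<open>Subtracting the term \<open>b m *\<^sub>R x (k m)\<close> of \<open>v\<close>
      leaves a relation on the block, so all coefficients equal the one at \<open>k m\<close>, which
      is \<open>- b m\<close>.\<close>
    define \<gamma> where "\<gamma> p = \<beta> p - (if p = k m then b m else 0)" for p
    have "\<gamma> p = \<gamma> (k m)"
    proof (rule block_relation_unique)
      fix j assume j: "j \<in> K m"
      have "(\<Sum>p\<in>Q m. \<gamma> p * coord (x p) j) = (\<Sum>p\<in>Q m. \<beta> p * coord (x p) j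
          - (if p = k m then b m * coord (x (k m)) j else 0))"
        by (intro sum.cong) (auto simp: \<gamma>_def algebra_simps)
      also have "\<dots> = 0"
        using k(1) by (simp add: sum_subtractf coef[OF j] coord_v[OF j])
      finally show "(\<Sum>p\<in>Q m. \<gamma> p * coord (x p) j) = 0" .
    qed (use p k in auto)
    then show ?thesis
      using p k(2) by (simp add: \<gamma>_def \<beta>_def)
  qed
  obtain \<tau>\<^sub>0 where \<tau>\<^sub>0: "\<And>\<tau>. \<tau>\<^sub>0 \<le> \<tau> \<Longrightarrow> \<exists>m. 12 \<le> card (K m) \<and>
      3 * card {i. blk i = m \<and> i < \<tau>} = card (K m)"
    using block_cut unfolding K_def by blast
  \<comment> \<open>The bound holds at every late cut, so no choice of bracket lengths avoids
    it.\<close>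
  have far: "1 / 48 \<le> (norm (S t - v))\<^sup>2" if t: "2 * \<tau>\<^sub>0 \<le> t" for t
  proof -
    \<comment> \<open>Half of \<open>r t\<close> rounded up, the number of even indices below
      \<open>r t\<close>.\<close>
    define \<tau> where "\<tau> = (r t + 1) div 2"
    have \<tau>: "2 * i < r t \<longleftrightarrow> i < \<tau>" for i
      unfolding \<tau>_def by linarith
    have "\<tau>\<^sub>0 \<le> \<tau>"
      using t seq_suble[OF r, of t] unfolding \<tau>_def by linarith
    then obtain m where m: "12 \<le> card (K m)" "3 * card {i. blk i = m \<and> i < \<tau>} = card (K m)"
      using \<tau>\<^sub>0 by blast
    define W where "W = insert (k m) {p \<in> Q m. p < r t}"
    have "coord (S t - v) j = - b m * (\<Sum>p\<in>W. coord (x p) j)" if j: "j \<in> K m" for j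
    proof -
      \<comment> \<open>The vector \<open>x (k m)\<close> is absent from the partial sum and enters
        only through \<open>- v\<close>, with the same coefficient \<open>- b m\<close>; this is why
        it belongs to \<open>W\<close> wherever the cut lies.\<close>
      define Q' where "Q' = {p \<in> Q m. p < r t} - {k m}"
      have "coord (S t) j = (\<Sum>p\<in>Q'. \<beta> p * coord (x p) j)"
        unfolding S[OF j] using \<beta>k[of m]
        by (intro sum.mono_neutral_right) (auto simp: Q'_def)
      also have "\<dots> = - b m * (\<Sum>p\<in>Q'. coord (x p) j)"
        unfolding sum_distrib_left by (intro sum.cong) (auto simp: Q'_def \<beta>)
      finally have "coord (S t - v) j = - b m * (coord (x (k m)) j + (\<Sum>p\<in>Q'. coord (x p) j))"
        by (simp add: coord_v[OF j] algebra_simps)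
      moreover have "W = insert (k m) Q'" "k m \<notin> Q'" "finite Q'"
        by (auto simp: W_def Q'_def)
      ultimately show ?thesis
        by simp
    qed
    then show ?thesis
      by (rule cut_block_norm_ge[OF m W_def k(1) \<tau>])
  qed
  have "(\<lambda>t. (norm (S (N t) - v))\<^sup>2) \<longlonglongrightarrow> (norm (v - v))\<^sup>2"
    using \<alpha> unfolding S_def by (intro tendsto_intros)
  moreover have "1 / 48 \<le> (norm (S (N t) - v))\<^sup>2" if "2 * \<tau>\<^sub>0 \<le> t" for t
    using that seq_suble[OF N, of t] by (intro far) linarith
  ultimately have "1 / 48 \<le> (norm (v - v))\<^sup>2"
    by (intro LIMSEQ_le_const[OF _ exI]) blast+
  then show False
    by simp
qed

end

section \<open>An interleaved partition\<close>

text \<open>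
  Write \<open>L m\<close> and \<open>U m\<close> for the sets of \<open>i\<close> with \<open>i + 1\<close> in the lower and in the upper half of
  \<open>[2 ^ m, 2 ^ Suc m)\<close>. The \<open>m\<close>-th block is \<open>L m \<union> U (Suc m)\<close>: between its two
  parts come \<open>U m\<close> and \<open>L (Suc m)\<close>, so every cut falls between the two parts of some block.
\<close>

definition dyadic_block :: "nat \<Rightarrow> nat" where
  "dyadic_block i = (let w = floor_log (Suc i) in if 2 * Suc i < 3 * 2 ^ w then w else w - 1)"

text \<open>The upper half of level \<open>Suc m\<close> runs from 3 * 2 ^ m to 4 * 2 ^ m, and
  \<open>w - 1\<close> moves it down to block \<open>m\<close>.\<close>

lemma dyadic_block_eq_iff:
  "dyadic_block i = m \<longleftrightarrow>
     2 ^ m \<le> Suc i \<and> 2 * Suc i < 3 * 2 ^ m \<or> 3 * 2 ^ m \<le> Suc i \<and> Suc i < 4 * 2 ^ m"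
    (is "_ \<longleftrightarrow> ?R m")
proof
  define w where "w = floor_log (Suc i)"
  have w: "2 ^ w \<le> Suc i" "Suc i < 2 * 2 ^ w"
    using floor_log_exp2_le[of "Suc i"] floor_log_exp2_gt[of "Suc i"] by (auto simp: w_def)
  show "?R m" if "dyadic_block i = m"
  proof (cases "2 * Suc i < 3 * 2 ^ w")
    case True
    then show ?thesis
      using that w by (auto simp: dyadic_block_def w_def Let_def)
  next
    case False
    \<comment> \<open>Level 0 contains only \<open>i = 0\<close>, which lies in the lower half, so
      the subtraction \<open>w - 1\<close> never truncates.\<close>
    then obtain u where "w = Suc u"
      using w by (cases w) auto
    then show ?thesis
      using that w False by (auto simp: dyadic_block_def w_def[symmetric] Let_def)
  qed
  show "dyadic_block i = m" if "?R m"
    using that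
  proof
    assume "2 ^ m \<le> Suc i \<and> 2 * Suc i < 3 * 2 ^ m"
    moreover from this have "floor_log (Suc i) = m"
      by (intro floor_log_eqI) auto
    ultimately show ?thesis
      by (simp add: dyadic_block_def)
  next
    assume "3 * 2 ^ m \<le> Suc i \<and> Suc i < 4 * 2 ^ m"
    moreover from this have "floor_log (Suc i) = Suc m"
      by (intro floor_log_eqI) auto
    ultimately show ?thesis
      by (simp add: dyadic_block_def)
  qed
qed

lemma dyadic_block_0: "{i. dyadic_block i = 0} = {0, 2}"
  unfolding dyadic_block_eq_iff by auto

lemma dyadic_block_Suc:
  "{i. dyadic_block i = Suc s} =
     {2 * 2 ^ s - 1..<3 * 2 ^ s - 1} \<union> {6 * 2 ^ s - 1..<8 * 2 ^ s - 1}"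
  unfolding dyadic_block_eq_iff by auto

text \<open>The early part has 2 ^ s elements and the late part twice as many, so a cut between them
  leaves exactly a third below.\<close>

lemma card_dyadic_block_Suc: "card {i. dyadic_block i = Suc s} = 3 * 2 ^ s"
  unfolding dyadic_block_Suc by (subst card_Un_disjoint) auto

interpretation dyadic: interleaved_blocks dyadic_block
proof
  show "2 ^ m \<le> card {i. dyadic_block i = m}" for m
    by (cases m) (simp_all add: dyadic_block_0 card_dyadic_block_Suc)
  have "\<exists>m. 12 \<le> card {i. dyadic_block i = m} \<and>
      3 * card {i. dyadic_block i = m \<and> i < \<tau>} = card {i. dyadic_block i = m}"
    if "12 \<le> \<tau>" for \<tau>
  proof -
    \<comment> \<open>Chosen so that 3 * 2 ^ s <= \<open>Suc \<tau>\<close> < 6 * 2 ^ s, which puts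
      the cut between the two parts of block \<open>Suc s\<close>.\<close>
    define s where "s = floor_log (Suc \<tau> div 3)"
    have s: "2 ^ s \<le> Suc \<tau> div 3" "Suc \<tau> div 3 < 2 * 2 ^ s"
      using floor_log_exp2_le[of "Suc \<tau> div 3"] floor_log_exp2_gt[of "Suc \<tau> div 3"] that
      by (auto simp: s_def)
    \<comment> \<open>From \<open>12 \<le> \<tau>\<close> the quotient by 3 is at least 4, so 2 ^ s
      exceeds 2; the block then has at least 12 elements.\<close>
    have "(4 :: nat) \<le> 2 ^ s"
    proof -
      have "(2 :: nat) ^ 1 < 2 ^ s"
        using s that by simp
      then have "2 \<le> s"
        by (subst (asm) power_strict_increasing_iff) auto
      then show ?thesis
        using power_increasing[of 2 s "2 :: nat"] by simp
    qed
    moreover have "{i. dyadic_block i = Suc s \<and> i < \<tau>} = {2 * 2 ^ s - 1..<3 * 2 ^ s - 1}"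
    proof -
      have "3 * 2 ^ s \<le> Suc \<tau>" "Suc \<tau> < 6 * 2 ^ s"
        using s by linarith+
      then show ?thesis
        unfolding dyadic_block_eq_iff by auto
    qed
    ultimately show ?thesis
      by (intro exI[of _ "Suc s"]) (simp add: card_dyadic_block_Suc)
  qed
  then show "\<exists>\<tau>\<^sub>0. \<forall>\<tau>\<ge>\<tau>\<^sub>0. \<exists>m. 12 \<le> card {i. dyadic_block i = m} \<and>
      3 * card {i. dyadic_block i = m \<and> i < \<tau>} = card {i. dyadic_block i = m}"
    by blast
qed

theorem theorem15:
  shows "\<not> (\<exists>S :: ell2 set. finite S \<and> span S = UNIV) \<and>
    separable_space (euclidean :: ell2 topology) \<and>
    (\<exists>x :: nat \<Rightarrow> ell2. frame x \<and>
       (\<forall>r :: nat \<Rightarrow> nat. strict_mono r \<longrightarrow> \<not> basis_with_brackets (x \<circ> r)))"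
proof (intro conjI)
  show "\<exists>x :: nat \<Rightarrow> ell2. frame x \<and>
      (\<forall>r :: nat \<Rightarrow> nat. strict_mono r \<longrightarrow> \<not> basis_with_brackets (x \<circ> r))"
    by (rule exI[of _ dyadic.x]) (simp add: dyadic.frame_x dyadic.no_basis_with_brackets)
qed (rule ell2_not_finitely_spanned separable_space_ell2)+

end
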